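(* Let $n\ge 1$, let $S$ be an $n$-sphere and let $v$ be a point of $S$. Then the space $S-v$ obtained from $S$ by deleting the point $v$ is an $n$-disk.
   Context: A digital space is a simple undirected graph with a finite or countable set of points (vertices). Subspaces are induced subgraphs; $H\subseteq G$ ("$H$ belongs to $G$") means $H$ is an induced subgraph of $G$. The rim $O(v)$ of a point $v$ is the subspace induced on the neighbors of $v$ (not containing $v$). $G-v$ is $G$ with the point $v$ deleted. Contractible graphs and contractible transformations: the one-point graph is contractible; the contractible transformations of a graph are (1) deleting a point $v$ with $O(v)$ contractible, (2) gluing a new point $v$ whose rim $O(v)$ is a contractible induced subgraph, (3) deleting an edge $(uv)$ with $O(u)\cap O(v)$ contractible, (4) adding an edge between non-adjacent points $u,v$ with $O(u)\cap O(v)$ contractible. A graph is contractible if it can be converted to a single point by a finite sequence of contractible transformations. Disks, spheres and manifolds are defined recursively. A 0-disk is a single point; a 0-sphere is the graph $S^0(a,b)$ with two non-adjacent points $a,b$. A 1-sphere is a finite connected graph in which the rim of each point is a 0-sphere. A 1-disk is a graph $S^1-v$ with $S^1$ a 1-sphere, $v\in S^1$. For $n\ge 1$: a closed $n$-manifold is a connected digital space in which the rim of every point is an $(n-1)$-sphere. An $n$-manifold with boundary is a connected space $N$ such that $N=M-v$ (up to isomorphism) for a closed $n$-manifold $M$ and a point $v\in M$; its boundary is $\partial N=O(v)$ and its interior is $\mathrm{Int}N=N-\partial N$. An $n$-disk is an $n$-manifold with boundary that is a contractible graph. For $n\ge 2$, an $n$-sphere is a graph $D\#C$ obtained from two $n$-disks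 $D,C$ with isomorphic boundaries by identifying each point of $\partial D$ with its counterpart in $\partial C$ under an isomorphism. *)

theory Defs
  imports "HOL-Library.Infinite_Typeclass" "HOL-Library.Countable_Set"
begin

section \<open>Digital spaces\<close>

text \<open>A graph is a pair of a point set and a set of edges, an edge being an unordered pair
  \<open>{u, v}\<close> of distinct points.\<close>

type_synonym 'a dgraph = "'a set \<times> 'a set set"

abbreviation points :: "'a dgraph \<Rightarrow> 'a set" where
  "points G \<equiv> fst G"

abbreviation edges :: "'a dgraph \<Rightarrow> 'a set set" where
  "edges G \<equiv> snd G"

definition digital_space :: "'a dgraph \<Rightarrow> bool" where
  "digital_space G \<longleftrightarrow> countable (points G) \<and>
     (\<forall>e \<in> edges G. \<exists>u v. u \<in> points G \<and> v \<in> points G \<and> u \<noteq> v \<and> e = {u, v})"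

definition induced :: "'a dgraph \<Rightarrow> 'a set \<Rightarrow> 'a dgraph" where
  "induced G W = (points G \<inter> W, {e \<in> edges G. e \<subseteq> W})"

definition del_point :: "'a dgraph \<Rightarrow> 'a \<Rightarrow> 'a dgraph" where
  "del_point G v = induced G (points G - {v})"

definition neighbours :: "'a dgraph \<Rightarrow> 'a \<Rightarrow> 'a set" where
  "neighbours G v = {u \<in> points G. {u, v} \<in> edges G}"

definition rim :: "'a dgraph \<Rightarrow> 'a \<Rightarrow> 'a dgraph" where
  "rim G v = induced G (neighbours G v)"

definition joint_rim :: "'a dgraph \<Rightarrow> 'a \<Rightarrow> 'a \<Rightarrow> 'a dgraph" where
  "joint_rim G u v = induced G (neighbours G u \<inter> neighbours G v)"

definition connected_space :: "'a dgraph \<Rightarrow> bool" where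
  "connected_space G \<longleftrightarrow> points G \<noteq> {} \<and>
     (\<forall>u \<in> points G. \<forall>v \<in> points G. (u, v) \<in> {(x, y). {x, y} \<in> edges G}\<^sup>*)"

definition graph_iso :: "('a \<Rightarrow> 'b) \<Rightarrow> 'a dgraph \<Rightarrow> 'b dgraph \<Rightarrow> bool" where
  "graph_iso f G H \<longleftrightarrow> bij_betw f (points G) (points H) \<and> edges H = (\<lambda>e. f ` e) ` edges G"

definition isomorphic :: "'a dgraph \<Rightarrow> 'b dgraph \<Rightarrow> bool" where
  "isomorphic G H \<longleftrightarrow> (\<exists>f. graph_iso f G H)"


section \<open>Contractible graphs\<close>

text \<open>Contractible graphs and contractible transformations refer to each other, so they are
  defined by a simultaneous induction. The type of points is required to be infinite here and
  below so that a new point is always available for gluing; any digital space has an isomorphic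
  copy over every infinite type.\<close>

inductive contractible :: "('a::infinite) dgraph \<Rightarrow> bool"
  and contr_trans :: "('a::infinite) dgraph \<Rightarrow> 'a dgraph \<Rightarrow> bool"
  where
    one_point: "contractible ({v}, {})"
  | trans_step: "\<lbrakk>contr_trans G H; contractible H\<rbrakk> \<Longrightarrow> contractible G"
  | delete_point:
      "\<lbrakk>digital_space G; v \<in> points G; contractible (rim G v)\<rbrakk>
       \<Longrightarrow> contr_trans G (del_point G v)"
  | glue_point:
      "\<lbrakk>digital_space G; v \<notin> points G; W \<subseteq> points G; contractible (induced G W)\<rbrakk>
       \<Longrightarrow> contr_trans G (insert v (points G), edges G \<union> {{v, w} | w. w \<in> W})"
  | delete_edge:
      "\<lbrakk>digital_space G; {u, v} \<in> edges G; contractible (joint_rim G u v)\<rbrakk>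
       \<Longrightarrow> contr_trans G (points G, edges G - {{u, v}})"
  | add_edge:
      "\<lbrakk>digital_space G; u \<in> points G; v \<in> points G; u \<noteq> v; {u, v} \<notin> edges G;
        contractible (joint_rim G u v)\<rbrakk>
       \<Longrightarrow> contr_trans G (points G, insert {u, v} (edges G))"


section \<open>Disks, spheres and manifolds\<close>

definition zero_sphere :: "'a dgraph \<Rightarrow> bool" where
  "zero_sphere G \<longleftrightarrow> (\<exists>a b. a \<noteq> b \<and> G = ({a, b}, {}))"

definition one_sphere :: "'a dgraph \<Rightarrow> bool" where
  "one_sphere G \<longleftrightarrow> digital_space G \<and> finite (points G) \<and> connected_space G \<and>
     (\<forall>v \<in> points G. zero_sphere (rim G v))"

text \<open>The space \<open>D # C\<close>, where \<open>h\<close> is an isomorphism from the subspace of \<open>C\<close> on \<open>BC\<close> to a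
  subspace of \<open>D\<close>: in the disjoint union of \<open>D\<close> and \<open>C\<close>, each point \<open>x\<close> of \<open>BC\<close> is
  identified with \<open>h x\<close>.\<close>

definition glue_incl :: "'b set \<Rightarrow> ('b \<Rightarrow> 'a) \<Rightarrow> 'b \<Rightarrow> 'a + 'b" where
  "glue_incl BC h x = (if x \<in> BC then Inl (h x) else Inr x)"

definition glue :: "'a dgraph \<Rightarrow> 'b dgraph \<Rightarrow> 'b set \<Rightarrow> ('b \<Rightarrow> 'a) \<Rightarrow> ('a + 'b) dgraph" where
  "glue D C BC h =
     (Inl ` points D \<union> glue_incl BC h ` points C,
      (\<lambda>e. Inl ` e) ` edges D \<union> (\<lambda>e. glue_incl BC h ` e) ` edges C)"

text \<open>The boundary of a manifold \<open>N = M - v\<close> is the rim of \<open>v\<close> in \<open>M\<close>, so it is not given by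
  the graph \<open>N\<close> alone. Therefore \<open>bounded_manifold n N B\<close> states that \<open>N\<close> is an
  \<open>n\<close>-manifold with boundary and that \<open>B\<close> is the set of boundary points coming from some
  presentation of \<open>N\<close> as \<open>M - v\<close>.\<close>

function digital_sphere :: "nat \<Rightarrow> ('a::infinite) dgraph \<Rightarrow> bool"
  and digital_disk :: "nat \<Rightarrow> ('a::infinite) dgraph \<Rightarrow> bool"
  and bounded_manifold :: "nat \<Rightarrow> ('a::infinite) dgraph \<Rightarrow> 'a set \<Rightarrow> bool"
  and closed_manifold :: "nat \<Rightarrow> ('a::infinite) dgraph \<Rightarrow> bool"
  where
    "digital_sphere 0 G \<longleftrightarrow> zero_sphere G"
  | "digital_sphere (Suc 0) G \<longleftrightarrow> one_sphere G"
  | "digital_sphere (Suc (Suc n)) G \<longleftrightarrow>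
       (\<exists>(D :: 'a dgraph) BD (C :: 'a dgraph) BC h.
          digital_disk (Suc (Suc n)) D \<and> bounded_manifold (Suc (Suc n)) D BD \<and>
          digital_disk (Suc (Suc n)) C \<and> bounded_manifold (Suc (Suc n)) C BC \<and>
          graph_iso h (induced C BC) (induced D BD) \<and>
          isomorphic (glue D C BC h) G)"
  | "digital_disk 0 G \<longleftrightarrow> (\<exists>v. G = ({v}, {}))"
  | "digital_disk (Suc 0) G \<longleftrightarrow> (\<exists>S v. one_sphere S \<and> v \<in> points S \<and> G = del_point S v)"
  | "digital_disk (Suc (Suc n)) G \<longleftrightarrow>
       (\<exists>B. bounded_manifold (Suc (Suc n)) G B) \<and> contractible G"
  | "bounded_manifold n N B \<longleftrightarrow>
       connected_space N \<and>
       (\<exists>(M :: 'a dgraph) v f. closed_manifold n M \<and> v \<in> points M \<and>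
          graph_iso f (del_point M v) N \<and> B = f ` points (rim M v))"
  | "closed_manifold 0 M \<longleftrightarrow> False"
  | "closed_manifold (Suc n) M \<longleftrightarrow>
       digital_space M \<and> connected_space M \<and> (\<forall>v \<in> points M. digital_sphere n (rim M v))"
  by pat_completeness auto

termination
  by (relation "measure (\<lambda>x. case x of
        Inl (Inl (n, _)) \<Rightarrow> 4 * n + 3
      | Inl (Inr (n, _)) \<Rightarrow> 4 * n + 2
      | Inr (Inl (n, _, _)) \<Rightarrow> 4 * n + 1
      | Inr (Inr (n, _)) \<Rightarrow> 4 * n)") auto

end

theory Submission
  imports Defs
begin

text \<open>Induction on the dimension. Write \<open>S = D # C\<close> and let \<open>K\<close> be the common boundary. Rims of points
  outside \<open>K\<close> are spheres because \<open>D\<close> and \<open>C\<close> are closed manifolds without a point; the rim of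
  a point of \<open>K\<close> is glued from two spheres without a point, which are disks by induction. So \<open>S\<close>
  is a closed manifold, and it remains to see that \<open>S - v\<close> is contractible. If \<open>v\<close> lies in \<open>K\<close>,
  then \<open>S - v\<close> is the union of \<open>D - v\<close> and \<open>C - v\<close> along \<open>K - v\<close>, and all three are contractible,
  since the rims of \<open>v\<close> in \<open>D\<close> and \<open>C\<close> and the space \<open>K - v\<close> are lower-dimensional spheres
  without a point. If \<open>x\<close> and \<open>y\<close> are adjacent, then \<open>y\<close> has a contractible rim in \<open>S - x\<close> and
  conversely, so \<open>S - x\<close>, \<open>S - x - y\<close> and \<open>S - y\<close> are all contractible or none is; as \<open>S\<close> is
  connected, contractibility of \<open>S - v\<close> for one point \<open>v\<close> gives it for all.\<close>


section \<open>Subspaces and isomorphic copies\<close>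

lemma edgeE:
  assumes "digital_space G" "e \<in> edges G"
  obtains u v where "u \<in> points G" "v \<in> points G" "u \<noteq> v" "e = {u, v}"
  using assms unfolding digital_space_def by blast

lemma edge_subset: "digital_space G \<Longrightarrow> e \<in> edges G \<Longrightarrow> e \<subseteq> points G"
  by (auto elim: edgeE)

lemma edge_points:
  assumes "digital_space G" "{u, v} \<in> edges G"
  shows "u \<in> points G" "v \<in> points G" "u \<noteq> v"
  using assms unfolding digital_space_def by (metis doubleton_eq_iff)+

lemma dgraph_eqI:
  assumes "digital_space G" "digital_space H" "points G = points H"
    and "\<And>u v. {u, v} \<in> edges G \<longleftrightarrow> {u, v} \<in> edges H"
  shows "G = H"
proof (rule prod_eqI)
  show "edges G = edges H"
    using assms(1,2,4) unfolding digital_space_def by (intro subset_antisym subsetI) metis+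
qed (fact assms(3))

lemma points_induced [simp]: "points (induced G W) = points G \<inter> W"
  by (simp add: induced_def)

lemma edge_induced [simp]: "e \<in> edges (induced G W) \<longleftrightarrow> e \<in> edges G \<and> e \<subseteq> W"
  by (simp add: induced_def)

lemma digital_space_induced:
  assumes "digital_space G"
  shows "digital_space (induced G W)"
  using assms unfolding digital_space_def by (fastforce intro: countable_subset)

lemma induced_induced: "induced (induced G U) W = induced G (U \<inter> W)"
  by (auto simp: induced_def)

text \<open>In a bare pair of points and edges, an edge could stick out of the point set and then
  tell \<open>U\<close> and \<open>W\<close> apart; in a digital space only the part of
  \<open>U\<close> and \<open>W\<close> among the points matters.\<close>

lemma induced_cong:
  "digital_space G \<Longrightarrow> points G \<inter> U = points G \<inter> W \<Longrightarrow> induced G U = induced G W"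
  by (rule dgraph_eqI) (auto intro: digital_space_induced dest: edge_points)

lemma induced_points: "digital_space G \<Longrightarrow> induced G (points G) = G"
  by (rule dgraph_eqI) (auto intro: digital_space_induced dest: edge_points)

lemma neighbours_induced: "x \<in> W \<Longrightarrow> neighbours (induced G W) x = W \<inter> neighbours G x"
  by (auto simp: neighbours_def)

lemma neighbours_subset: "neighbours G x \<subseteq> points G"
  by (auto simp: neighbours_def)

lemma neighbours_sym:
  "x \<in> points G \<Longrightarrow> y \<in> points G \<Longrightarrow> x \<in> neighbours G y \<longleftrightarrow> y \<in> neighbours G x"
  by (simp add: neighbours_def insert_commute)

lemma not_self_neighbour: "digital_space G \<Longrightarrow> x \<notin> neighbours G x"
  by (auto simp: neighbours_def dest: edge_points(3)[of G x x])

lemma points_rim [simp]: "points (rim G x) = neighbours G x"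
  by (auto simp: rim_def neighbours_def)

lemma rim_induced: "x \<in> W \<Longrightarrow> rim (induced G W) x = induced G (W \<inter> neighbours G x)"
  by (auto simp: rim_def neighbours_induced induced_induced)

lemma points_del_point [simp]: "points (del_point G x) = points G - {x}"
  by (auto simp: del_point_def)

lemma del_point_eq_induced: "digital_space G \<Longrightarrow> del_point G x = induced G (- {x})"
  unfolding del_point_def by (rule induced_cong) auto

lemma del_point_induced:
  "digital_space G \<Longrightarrow> del_point (induced G W) x = induced G (W - {x})"
  by (simp add: del_point_eq_induced digital_space_induced induced_induced Diff_eq)

lemma del_point_rim:
  "digital_space G \<Longrightarrow> del_point (rim G x) y = induced G (neighbours G x - {y})"
  by (simp add: rim_def del_point_induced)

lemma digital_space_rim: "digital_space G \<Longrightarrow> digital_space (rim G x)"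
  by (simp add: rim_def digital_space_induced)

lemma digital_space_del_point: "digital_space G \<Longrightarrow> digital_space (del_point G x)"
  by (simp add: del_point_def digital_space_induced)

lemma rim_del_point:
  assumes "digital_space G" "x \<noteq> y"
  shows "rim (del_point G y) x = del_point (rim G x) y"
  using assms by (simp add: del_point_eq_induced rim_induced del_point_rim Diff_eq Int_commute)

section \<open>Isomorphic copies obtained by renaming points along an injection\<close>

definition map_graph :: "('a \<Rightarrow> 'b) \<Rightarrow> 'a dgraph \<Rightarrow> 'b dgraph" where
  "map_graph f G = (f ` points G, (\<lambda>e. f ` e) ` edges G)"

lemma points_map_graph [simp]: "points (map_graph f G) = f ` points G"
  by (simp add: map_graph_def)

text \<open>Turns the relation into an equation, so that invariance under isomorphism can be proved
  by rewriting with \<open>map_graph\<close>.\<close>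

lemma graph_iso_iff: "graph_iso f G H \<longleftrightarrow> inj_on f (points G) \<and> H = map_graph f G"
  by (auto simp: graph_iso_def map_graph_def bij_betw_def prod_eq_iff)

lemma map_graph_comp: "map_graph f (map_graph g G) = map_graph (f \<circ> g) G"
  by (simp add: map_graph_def image_comp comp_def)

lemma map_graph_id: "map_graph (\<lambda>x. x) G = G"
  by (simp add: map_graph_def)

lemma edge_map_graph:
  assumes "digital_space G" "inj_on f (points G)" "u \<in> points G" "v \<in> points G"
  shows "{f u, f v} \<in> edges (map_graph f G) \<longleftrightarrow> {u, v} \<in> edges G"
proof
  assume "{f u, f v} \<in> edges (map_graph f G)"
  then obtain e where e: "e \<in> edges G" "f ` {u, v} = f ` e"
    by (auto simp: map_graph_def)
  then have "e = {u, v}"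
    using inj_on_image_eq_iff[OF assms(2), of "{u, v}" e] assms edge_subset[OF assms(1) e(1)] by auto
  then show "{u, v} \<in> edges G"
    using e by simp
qed (auto simp: map_graph_def intro!: image_eqI[of _ _ "{u, v}"])

lemma digital_space_map_graph:
  assumes "digital_space G" "inj_on f (points G)"
  shows "digital_space (map_graph f G)"
  unfolding digital_space_def
proof (intro conjI ballI)
  show "countable (points (map_graph f G))"
    using assms by (simp add: digital_space_def)
  fix e assume "e \<in> edges (map_graph f G)"
  then obtain e' where "e' \<in> edges G" "e = f ` e'"
    by (auto simp: map_graph_def)
  then show "\<exists>u v. u \<in> points (map_graph f G) \<and> v \<in> points (map_graph f G) \<and> u \<noteq> v \<and> e = {u, v}"
    using assms by (auto elim!: edgeE dest: inj_onD)
qed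

lemma map_graph_cong:
  assumes "digital_space G" "\<And>x. x \<in> points G \<Longrightarrow> f x = g x"
  shows "map_graph f G = map_graph g G"
  using assms edge_subset[OF assms(1)] unfolding map_graph_def
  by (auto intro!: image_cong)

lemma induced_map_graph:
  assumes "digital_space G" "inj_on f (points G)" "W \<subseteq> points G"
  shows "induced (map_graph f G) (f ` W) = map_graph f (induced G W)"
proof -
  have "f ` e \<subseteq> f ` W \<longleftrightarrow> e \<subseteq> W" if "e \<in> edges G" for e
    using assms edge_subset[OF assms(1) that] by (blast dest: inj_onD)
  then show ?thesis
    using assms(3) by (auto simp: induced_def map_graph_def inj_on_def Int_absorb1 image_mono)
qed

lemma neighbours_map_graph:
  assumes "digital_space G" "inj_on f (points G)" "x \<in> points G"
  shows "neighbours (map_graph f G) (f x) = f ` neighbours G x"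
  using edge_map_graph[OF assms(1,2) _ assms(3)] by (auto simp: neighbours_def)

lemma rim_map_graph:
  assumes "digital_space G" "inj_on f (points G)" "x \<in> points G"
  shows "rim (map_graph f G) (f x) = map_graph f (rim G x)"
  unfolding rim_def neighbours_map_graph[OF assms]
  by (rule induced_map_graph[OF assms(1,2)]) (rule neighbours_subset)

lemma del_point_map_graph:
  assumes "digital_space G" "inj_on f (points G)" "x \<in> points G"
  shows "del_point (map_graph f G) (f x) = map_graph f (del_point G x)"
proof -
  have "points (map_graph f G) - {f x} = f ` (points G - {x})"
    using assms(2,3) by (auto simp: inj_on_def)
  then show ?thesis
    unfolding del_point_def using induced_map_graph[OF assms(1,2)] by (metis Diff_subset)
qed

lemma points_joint_rim: "points (joint_rim G u v) \<subseteq> points G"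
  by (simp add: joint_rim_def)

lemma joint_rim_map_graph:
  assumes "digital_space G" "inj_on f (points G)" "u \<in> points G" "v \<in> points G"
  shows "joint_rim (map_graph f G) (f u) (f v) = map_graph f (joint_rim G u v)"
proof -
  have "f ` neighbours G u \<inter> f ` neighbours G v = f ` (neighbours G u \<inter> neighbours G v)"
    using inj_on_image_Int[OF assms(2) neighbours_subset neighbours_subset] by simp
  then show ?thesis
    unfolding joint_rim_def
    using assms induced_map_graph[OF assms(1,2), of "neighbours G u \<inter> neighbours G v"]
      neighbours_subset[of G u] by (auto simp: neighbours_map_graph)
qed


section \<open>Connectedness\<close>

text \<open>Up to elements outside the graph, such a set is a union of connected components. Testing
  connectedness against these sets replaces reasoning about paths.\<close>

definition edge_closed :: "'a dgraph \<Rightarrow> 'a set \<Rightarrow> bool" where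
  "edge_closed G X \<longleftrightarrow> (\<forall>x y. {x, y} \<in> edges G \<longrightarrow> x \<in> X \<longrightarrow> y \<in> X)"

lemma edge_closedI: "(\<And>x y. {x, y} \<in> edges G \<Longrightarrow> x \<in> X \<Longrightarrow> y \<in> X) \<Longrightarrow> edge_closed G X"
  by (simp add: edge_closed_def)

lemma edge_closedD: "edge_closed G X \<Longrightarrow> {x, y} \<in> edges G \<Longrightarrow> x \<in> X \<longleftrightarrow> y \<in> X"
  unfolding edge_closed_def by (metis insert_commute)

lemma edge_closed_induced: "edge_closed G X \<Longrightarrow> edge_closed (induced G W) X"
  unfolding edge_closed_def edge_induced by blast

lemma connected_spaceD:
  assumes "connected_space G" "edge_closed G X" "x \<in> X" "x \<in> points G"
  shows "points G \<subseteq> X"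
proof
  fix y assume "y \<in> points G"
  then have "(x, y) \<in> {(x, y). {x, y} \<in> edges G}\<^sup>*"
    using assms(1,4) by (auto simp: connected_space_def)
  then show "y \<in> X"
    by induction (use assms(2,3) in \<open>auto dest: edge_closedD\<close>)
qed

lemma connected_spaceI:
  assumes "points G \<noteq> {}"
    and "\<And>X x. edge_closed G X \<Longrightarrow> x \<in> X \<Longrightarrow> x \<in> points G \<Longrightarrow> points G \<subseteq> X"
  shows "connected_space G"
proof -
  let ?E = "{(x, y). {x, y} \<in> edges G}"
  \<comment> \<open>The set of points reachable from \<open>x\<close> is itself closed under edges,
    so the hypothesis applies to it.\<close>
  have "points G \<subseteq> ?E\<^sup>* `` {x}" if "x \<in> points G" for x
    by (rule assms(2)[of _ x])
      (use that in \<open>auto intro!: edge_closedI intro: rtrancl_into_rtrancl\<close>)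
  then show ?thesis
    using assms(1) by (auto simp: connected_space_def)
qed

lemma connected_space_map_graph:
  assumes "connected_space G"
  shows "connected_space (map_graph f G)"
proof (rule connected_spaceI)
  show "points (map_graph f G) \<noteq> {}"
    using assms by (simp add: connected_space_def)
  fix X x
  assume X: "edge_closed (map_graph f G) X" "x \<in> X" "x \<in> points (map_graph f G)"
  then obtain u where u: "u \<in> points G" "x = f u"
    by auto
  have "edge_closed G (f -` X)"
  proof (rule edge_closedI)
    fix a b assume "{a, b} \<in> edges G" "a \<in> f -` X"
    moreover from this have "{f a, f b} \<in> edges (map_graph f G)"
      by (auto simp: map_graph_def intro!: image_eqI[of _ _ "{a, b}"])
    ultimately show "b \<in> f -` X"
      using edge_closedD[OF X(1)] by simp
  qed
  from connected_spaceD[OF assms this] show "points (map_graph f G) \<subseteq> X"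
    using u X(2) by auto
qed

text \<open>An edge-closed set that meets \<open>A\<close> contains \<open>A\<close>, and likewise
  for \<open>B\<close>; a common point carries it from one part to the other.\<close>

lemma connected_space_Un:
  assumes "connected_space (induced G A)" "connected_space (induced G B)"
    and "points G = A \<union> B" "A \<inter> B \<noteq> {}"
  shows "connected_space G"
proof (rule connected_spaceI)
  show "points G \<noteq> {}"
    using assms(3,4) by auto
  fix X x
  assume X: "edge_closed G X" "x \<in> X" "x \<in> points G"
  have "A \<subseteq> X" if "u \<in> A" "u \<in> X" for u
    using connected_spaceD[OF assms(1) edge_closed_induced[OF X(1)], of u] that assms(3) by auto
  moreover have "B \<subseteq> X" if "u \<in> B" "u \<in> X" for u
    using connected_spaceD[OF assms(2) edge_closed_induced[OF X(1)], of u] that assms(3) by auto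
  ultimately show "points G \<subseteq> X"
    using X assms(3,4) by blast
qed


section \<open>Contractible graphs\<close>

lemma digital_space_contr_trans: "contr_trans G H \<Longrightarrow> digital_space G"
  by (auto elim: contr_trans.cases)

lemma digital_space_contractible: "contractible G \<Longrightarrow> digital_space G"
  by (erule contractible.cases) (simp_all add: digital_space_contr_trans, simp add: digital_space_def)

text \<open>A transformation changes the point set by at most one point, so finiteness passes back
  along a chain ending in a single point.\<close>

lemma finite_contractible: "contractible G \<Longrightarrow> finite (points G)"
  by (induction rule: contractible_contr_trans.inducts(1)
      [where ?P2.0 = "\<lambda>G H. finite (points H) \<longrightarrow> finite (points G)"]) auto

lemma contractible_map_graph:
  fixes f :: "'a::infinite \<Rightarrow> 'b::infinite"
  assumes "contractible G" "inj_on f (points G)"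
  shows "contractible (map_graph f G)"
proof -
  have "\<forall>f :: 'a \<Rightarrow> 'b. inj_on f (points G) \<longrightarrow> contractible (map_graph f G)"
    using assms(1)
  proof (induction rule: contractible_contr_trans.inducts(1)
      [where ?P2.0 = "\<lambda>G H. finite (points H) \<longrightarrow>
        (\<forall>f :: 'a \<Rightarrow> 'b. inj_on f (points H) \<longrightarrow> contractible (map_graph f H)) \<longrightarrow>
        (\<forall>f :: 'a \<Rightarrow> 'b. inj_on f (points G) \<longrightarrow> contractible (map_graph f G))"])
    case (one_point v)
    show ?case
      by (simp add: map_graph_def contractible_contr_trans.one_point)
  next
    case (trans_step G H)
    then show ?case
      using finite_contractible by blast
  next
    case (delete_point G v)
    show ?case
    proof (intro impI allI)
      fix f :: "'a \<Rightarrow> 'b"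
      assume H: "\<forall>f :: 'a \<Rightarrow> 'b. inj_on f (points (del_point G v)) \<longrightarrow>
          contractible (map_graph f (del_point G v))"
        and f: "inj_on f (points G)"
      have "inj_on f (neighbours G v)"
        using f neighbours_subset by (rule inj_on_subset)
      then have "contr_trans (map_graph f G) (del_point (map_graph f G) (f v))"
        using delete_point f
        by (intro contractible_contr_trans.delete_point)
          (auto simp: digital_space_map_graph rim_map_graph)
      moreover have "contractible (del_point (map_graph f G) (f v))"
        using H f delete_point by (simp add: del_point_map_graph inj_on_diff)
      ultimately show "contractible (map_graph f G)"
        by (rule contractible_contr_trans.trans_step)
    qed
  next
    case (glue_point G v W)
    let ?H = "(insert v (points G), edges G \<union> {{v, w} | w. w \<in> W})"
    show ?case
    proof (intro impI allI)
      fix f :: "'a \<Rightarrow> 'b"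
      assume fin: "finite (points ?H)"
        and H: "\<forall>f :: 'a \<Rightarrow> 'b. inj_on f (points ?H) \<longrightarrow> contractible (map_graph f ?H)"
        and f: "inj_on f (points G)"
      have "finite (f ` points G)"
        using fin by simp
      then obtain b where b: "b \<notin> f ` points G"
        using ex_new_if_finite[OF infinite_UNIV] by blast
      \<comment> \<open>The value of \<open>f\<close> at \<open>v\<close> may already be taken on
        \<open>points G\<close>, so \<open>v\<close> is sent to the fresh point \<open>b\<close>
        instead.\<close>
      let ?g = "f(v := b)"
      have *: "?g ` e = f ` e" if "e \<subseteq> points G" for e
        using that glue_point(2) by auto
      have g: "inj_on ?g (points ?H)"
        using f b glue_point(2) by (auto simp: inj_on_def)
      have "map_graph ?g ?H = (insert b (points (map_graph f G)),
          edges (map_graph f G) \<union> {{b, w} | w. w \<in> f ` W})"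
      proof -
        have "(\<lambda>e. ?g ` e) ` edges G = (\<lambda>e. f ` e) ` edges G"
          by (intro image_cong refl * edge_subset[OF glue_point(1)])
        moreover have "(\<lambda>e. ?g ` e) ` {{v, w} | w. w \<in> W} = {{b, w} | w. w \<in> f ` W}"
          unfolding Setcompr_eq_image image_image
          by (rule image_cong) (use glue_point(2,3) in auto)
        ultimately show ?thesis
          using *[OF subset_refl]
          by (simp only: map_graph_def fst_conv snd_conv image_Un image_insert fun_upd_same)
      qed
      moreover have "contr_trans (map_graph f G) (insert b (points (map_graph f G)),
          edges (map_graph f G) \<union> {{b, w} | w. w \<in> f ` W})"
      proof (rule contractible_contr_trans.glue_point)
        show "contractible (induced (map_graph f G) (f ` W))"
          using glue_point f by (simp add: induced_map_graph inj_on_def)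
      qed (use glue_point f b in \<open>auto simp: digital_space_map_graph\<close>)
      ultimately have "contr_trans (map_graph f G) (map_graph ?g ?H)"
        by (simp only:)
      then show "contractible (map_graph f G)"
        using H[rule_format, OF g] by (rule contractible_contr_trans.trans_step)
    qed
  next
    case (delete_edge G u v)
    show ?case
    proof (intro impI allI)
      fix f :: "'a \<Rightarrow> 'b"
      assume H: "\<forall>f :: 'a \<Rightarrow> 'b. inj_on f (points (points G, edges G - {{u, v}})) \<longrightarrow>
          contractible (map_graph f (points G, edges G - {{u, v}}))"
        and f: "inj_on f (points G)"
      have uv: "u \<in> points G" "v \<in> points G"
        by (rule edge_points[OF delete_edge(1,2)])+
      have "(\<lambda>e. f ` e) ` (edges G - {{u, v}}) = edges (map_graph f G) - {{f u, f v}}"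
        using inj_on_image_set_diff
          [OF inj_on_subset[OF inj_on_image_Pow[OF f]], of "edges G" "edges G" "{{u, v}}"]
          edge_subset[OF delete_edge(1)] delete_edge(2)
        by (auto simp: map_graph_def)
      then have "map_graph f (points G, edges G - {{u, v}}) =
          (points (map_graph f G), edges (map_graph f G) - {{f u, f v}})"
        by (simp add: map_graph_def)
      moreover have "contr_trans (map_graph f G)
          (points (map_graph f G), edges (map_graph f G) - {{f u, f v}})"
      proof (rule contractible_contr_trans.delete_edge)
        show "contractible (joint_rim (map_graph f G) (f u) (f v))"
          using delete_edge(4) inj_on_subset[OF f points_joint_rim]
          by (simp add: joint_rim_map_graph[OF delete_edge(1) f uv])
      qed (use delete_edge f uv in \<open>auto simp: digital_space_map_graph edge_map_graph\<close>)
      ultimately have "contr_trans (map_graph f G) (map_graph f (points G, edges G - {{u, v}}))"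
        by (simp only:)
      then show "contractible (map_graph f G)"
        using H[rule_format, of f] f by (auto intro: contractible_contr_trans.trans_step)
    qed
  next
    case (add_edge G u v)
    show ?case
    proof (intro impI allI)
      fix f :: "'a \<Rightarrow> 'b"
      assume H: "\<forall>f :: 'a \<Rightarrow> 'b. inj_on f (points (points G, insert {u, v} (edges G))) \<longrightarrow>
          contractible (map_graph f (points G, insert {u, v} (edges G)))"
        and f: "inj_on f (points G)"
      have "map_graph f (points G, insert {u, v} (edges G)) =
          (points (map_graph f G), insert {f u, f v} (edges (map_graph f G)))"
        by (simp add: map_graph_def)
      moreover have "contr_trans (map_graph f G)
          (points (map_graph f G), insert {f u, f v} (edges (map_graph f G)))"
      proof (rule contractible_contr_trans.add_edge)
        show "contractible (joint_rim (map_graph f G) (f u) (f v))"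
          using add_edge(7) inj_on_subset[OF f points_joint_rim]
          by (simp add: joint_rim_map_graph[OF add_edge(1) f add_edge(2,3)])
      qed (use add_edge f in \<open>auto simp: digital_space_map_graph edge_map_graph dest: inj_onD\<close>)
      ultimately have "contr_trans (map_graph f G) (map_graph f (points G, insert {u, v} (edges G)))"
        by (simp only:)
      then show "contractible (map_graph f G)"
        using H[rule_format, of f] f by (auto intro: contractible_contr_trans.trans_step)
    qed
  qed
  then show ?thesis
    using assms(2) by blast
qed

text \<open>Connectedness is pulled back along each transformation, using that the rims involved are
  nonempty and connected by induction: a deleted point has a neighbour left, a detour through a
  glued point can be replaced by one inside its rim, and an added edge joins points with a common
  neighbour.\<close>

lemma contractible_connected: "contractible G \<Longrightarrow> connected_space G"
proof (induction rule: contractible_contr_trans.inducts(1)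
    [where ?P2.0 = "\<lambda>G H. connected_space H \<longrightarrow> connected_space G"])
  case (delete_point G v)
  then obtain w where "w \<in> neighbours G v"
    by (auto simp: connected_space_def)
  then have w: "w \<in> points G" "{w, v} \<in> edges G" "w \<noteq> v"
    using edge_points(3)[OF delete_point(1)] by (auto simp: neighbours_def)
  show ?case
  proof
    assume H: "connected_space (del_point G v)"
    show "connected_space G"
    proof (rule connected_spaceI)
      fix X x
      assume X: "edge_closed G X" "x \<in> X" "x \<in> points G"
      have *: "points G - {v} \<subseteq> X" if "u \<in> X" "u \<in> points G - {v}" for u
        using connected_spaceD[OF H, of X u] that X(1)
        by (simp add: del_point_def edge_closed_induced) blast
      have "points G - {v} \<subseteq> X"
        using *[of x] *[of w] X w edge_closedD[OF X(1) w(2)] by blast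
      then show "points G \<subseteq> X"
        using X w edge_closedD[OF X(1) w(2)] by blast
    qed (use w in auto)
  qed
next
  case (glue_point G v W)
  let ?H = "(insert v (points G), edges G \<union> {{v, w} | w. w \<in> W})"
  obtain w where w: "w \<in> W"
    using glue_point by (auto simp: connected_space_def)
  show ?case
  proof
    assume H: "connected_space ?H"
    show "connected_space G"
    proof (rule connected_spaceI)
      fix X x
      assume X: "edge_closed G X" "x \<in> X" "x \<in> points G"
      have W: "W \<subseteq> X" if "u \<in> X" "u \<in> W" for u
        using connected_spaceD[OF glue_point(5) edge_closed_induced[OF X(1)], of u]
          that glue_point(3) by auto
      \<comment> \<open>Since \<open>W\<close> is connected, \<open>X\<close> contains all of
        \<open>W\<close> or misses it. Putting \<open>v\<close> into the set in the first case and
        leaving it out in the second makes the set closed under the new edges too.\<close>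
      define Y where "Y = (if w \<in> X then insert v X else X - {v})"
      have "edge_closed ?H Y"
      proof (rule edge_closedI)
        fix a b
        assume ab: "{a, b} \<in> edges ?H" "a \<in> Y"
        show "b \<in> Y"
        proof (cases "{a, b} \<in> edges G")
          case True
          then have "a \<noteq> v" "b \<noteq> v"
            using edge_points[OF glue_point(1)] glue_point(2) by blast+
          then show ?thesis
            using ab(2) edge_closedD[OF X(1) True] by (auto simp: Y_def split: if_splits)
        next
          case False
          then have "a = v \<and> b \<in> W \<and> b \<noteq> v \<or> b = v \<and> a \<in> W \<and> a \<noteq> v"
            using ab(1) glue_point(2,3) by (auto simp: doubleton_eq_iff)
          then show ?thesis
            using ab(2) W[of w] W[of a] w by (auto simp: Y_def split: if_splits)
        qed
      qed
      moreover have "x \<in> Y"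
        using X glue_point(2) by (auto simp: Y_def)
      ultimately have "points G \<subseteq> Y"
        using connected_spaceD[OF H, of Y x] X(3) by simp
      then show "points G \<subseteq> X"
        using glue_point(2) by (auto simp: Y_def split: if_splits)
    qed (use w glue_point(3) in auto)
  qed
next
  case (delete_edge G u v)
  show ?case
  proof
    assume H: "connected_space (points G, edges G - {{u, v}})"
    show "connected_space G"
    proof (rule connected_spaceI)
      fix X x
      assume X: "edge_closed G X" "x \<in> X" "x \<in> points G"
      then have "edge_closed (points G, edges G - {{u, v}}) X"
        by (auto intro!: edge_closedI dest: edge_closedD)
      from connected_spaceD[OF H this] show "points G \<subseteq> X"
        using X by simp
    qed (use H in \<open>simp add: connected_space_def\<close>)
  qed
next
  case (add_edge G u v)
  then obtain w where "w \<in> neighbours G u \<inter> neighbours G v"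
    by (auto simp: joint_rim_def connected_space_def)
  then have w: "{w, u} \<in> edges G" "{w, v} \<in> edges G"
    by (auto simp: neighbours_def)
  show ?case
  proof
    assume H: "connected_space (points G, insert {u, v} (edges G))"
    show "connected_space G"
    proof (rule connected_spaceI)
      fix X x
      assume X: "edge_closed G X" "x \<in> X" "x \<in> points G"
      have "edge_closed (points G, insert {u, v} (edges G)) X"
      proof (rule edge_closedI)
        fix a b
        assume ab: "{a, b} \<in> edges (points G, insert {u, v} (edges G))" "a \<in> X"
        then have "{a, b} \<in> edges G \<or> a = u \<and> b = v \<or> a = v \<and> b = u"
          by (auto simp: doubleton_eq_iff)
        then show "b \<in> X"
          using ab(2) edge_closedD[OF X(1)] w by blast
      qed
      from connected_spaceD[OF H this] show "points G \<subseteq> X"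
        using X by simp
    qed (use add_edge(2) in auto)
  qed
qed (auto simp: connected_space_def)

section \<open>Removal of points with contractible rims, cones and unions\<close>

lemma contractible_remove_iff:
  assumes "digital_space G" "W \<subseteq> points G" "x \<in> W"
    and rim: "contractible (induced G (W \<inter> neighbours G x))"
  shows "contractible (induced G W) \<longleftrightarrow> contractible (induced G (W - {x}))"
proof
  let ?V = "W \<inter> neighbours G x"
  let ?H = "induced G (W - {x})"
  have xV: "x \<notin> neighbours G x"
    using assms(1) by (rule not_self_neighbour)
  \<comment> \<open>Chains of transformations run from the graph to a single point. Contractibility
    therefore passes from the larger space to the smaller one by first gluing \<open>x\<close> back;
    the other direction deletes \<open>x\<close>.\<close>
  have "contr_trans ?H (insert x (points ?H), edges ?H \<union> {{x, w} | w. w \<in> ?V})"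
  proof (rule contractible_contr_trans.glue_point)
    have "induced ?H ?V = induced G ?V"
      unfolding induced_induced by (rule induced_cong) (use assms(1) xV in auto)
    then show "contractible (induced ?H ?V)"
      using rim by simp
  qed (use assms xV in \<open>auto simp: digital_space_induced neighbours_def\<close>)
  moreover have "(insert x (points ?H), edges ?H \<union> {{x, w} | w. w \<in> ?V}) = induced G W"
  proof (rule prod_eqI)
    have "e \<in> edges ?H \<union> {{x, w} | w. w \<in> ?V}" if e: "e \<in> edges G" "e \<subseteq> W" for e
    proof (cases "x \<in> e")
      case True
      then obtain w where "e = {x, w}" "w \<in> points G"
        using e by (auto elim: edgeE[OF assms(1)])
      then show ?thesis
        using e by (auto simp: neighbours_def insert_commute)
    qed (use e in auto)
    moreover have "e \<in> edges G \<and> e \<subseteq> W" if "e \<in> edges ?H \<union> {{x, w} | w. w \<in> ?V}" for e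
      using that assms(3) by (auto simp: neighbours_def insert_commute)
    ultimately show "edges (insert x (points ?H), edges ?H \<union> {{x, w} | w. w \<in> ?V}) = edges (induced G W)"
      unfolding snd_conv by (intro subset_antisym subsetI) (simp_all only: edge_induced)
  qed (use assms in auto)
  ultimately show "contractible ?H" if "contractible (induced G W)"
    using that contractible_contr_trans.trans_step by metis
  have "contr_trans (induced G W) (del_point (induced G W) x)"
    by (rule contractible_contr_trans.delete_point)
      (use assms in \<open>auto simp: digital_space_induced rim_induced\<close>)
  then show "contractible (induced G W)" if "contractible ?H"
    using that assms(1) contractible_contr_trans.trans_step by (metis del_point_induced)
qed

lemma contractible_singleton:
  assumes "digital_space G" "a \<in> points G"
  shows "contractible (induced G {a})"
proof -
  have "induced G {a} = ({a}, {})"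
    using assms edge_points(3)[OF assms(1), of a a]
    by (auto simp: induced_def subset_singleton_iff elim: edgeE[OF assms(1)])
  then show ?thesis
    by (simp add: contractible_contr_trans.one_point)
qed

text \<open>For a point \<open>x\<close> other than the apex \<open>a\<close>, both the rim of
  \<open>x\<close> and the rest after deleting \<open>x\<close> are smaller cones with apex
  \<open>a\<close>, so induction on proper subsets covers both.\<close>

lemma contractible_cone:
  assumes "digital_space G" "finite W" "W \<subseteq> points G" "a \<in> W"
    and "\<And>w. w \<in> W \<Longrightarrow> w \<noteq> a \<Longrightarrow> a \<in> neighbours G w"
  shows "contractible (induced G W)"
  using assms(2-)
proof (induction W rule: finite_psubset_induct)
  case (psubset W)
  show ?case
  proof (cases "W = {a}")
    case True
    then show ?thesis
      using assms(1) psubset by (simp add: contractible_singleton)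
  next
    case False
    then obtain x where x: "x \<in> W" "x \<noteq> a"
      using psubset.prems by blast
    have "contractible (induced G (W \<inter> neighbours G x))"
      by (rule psubset.IH) (use x psubset.prems not_self_neighbour[OF assms(1)] in auto)
    moreover have "contractible (induced G (W - {x}))"
      by (rule psubset.IH) (use x psubset.prems in auto)
    ultimately show ?thesis
      using contractible_remove_iff[OF assms(1)] x psubset.prems by blast
  qed
qed

text \<open>Glue a cone with a new apex over \<open>B\<close>. The points of \<open>B - A\<close> then have cones as rims and can
  be deleted; after that the apex has rim \<open>A \<inter> B\<close> and can be deleted as well, which leaves \<open>A\<close>.\<close>

lemma contractible_Un:
  assumes "digital_space G" "finite (points G)" "points G = A \<union> B"
    and cross: "\<And>e. e \<in> edges G \<Longrightarrow> e \<subseteq> A \<or> e \<subseteq> B"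
    and "contractible (induced G A)" "contractible (induced G B)" "contractible (induced G (A \<inter> B))"
  shows "contractible G"
proof -
  obtain a where a: "a \<notin> points G"
    using ex_new_if_finite[OF infinite_UNIV assms(2)] by blast
  define H where "H = (insert a (points G), edges G \<union> {{a, w} | w. w \<in> B})"
  have "contr_trans G H"
    unfolding H_def by (rule contractible_contr_trans.glue_point) (use assms a in auto)
  moreover have "contractible H"
  proof -
    have H: "digital_space H"
      unfolding digital_space_def
    proof (intro conjI ballI)
      fix e assume "e \<in> edges H"
      then show "\<exists>u v. u \<in> points H \<and> v \<in> points H \<and> u \<noteq> v \<and> e = {u, v}"
        using a assms(3) by (auto simp: H_def elim!: edgeE[OF assms(1)])
    qed (use assms(1) in \<open>simp add: H_def digital_space_def\<close>)
    have ind: "induced H W = induced G W" if "W \<subseteq> points G" for W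
      using that a by (auto simp: H_def induced_def)
    have "{u, a} \<notin> edges G" for u
      using a edge_points[OF assms(1)] by blast
    then have na: "neighbours H a = B"
      using a assms(3) by (auto simp: H_def neighbours_def doubleton_eq_iff)
    have nx: "neighbours H x \<subseteq> insert a B" "a \<in> neighbours H x" if x: "x \<in> B - A" for x
    proof -
      have "u \<in> B" if "{u, x} \<in> edges G" for u
        using cross[OF that] x by blast
      then show "neighbours H x \<subseteq> insert a B" "a \<in> neighbours H x"
        using x by (auto simp: H_def neighbours_def doubleton_eq_iff)
    qed
    \<comment> \<open>The deletions are read backwards: \<open>F\<close> holds the points of
      \<open>B - A\<close> still present, the empty set leaves \<open>A\<close> with the apex, and
      \<open>F = B - A\<close> gives all of \<open>H\<close>.\<close>
    have "contractible (induced H (insert a A \<union> F))" if "finite F" "F \<subseteq> B - A" for F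
      using that
    proof induction
      case empty
      have "insert a A \<inter> neighbours H a = A \<inter> B" "insert a A - {a} = A"
        using na a assms(3) by auto
      moreover have "contractible (induced H (A \<inter> B))" "contractible (induced H A)"
        using assms ind[of A] ind[of "A \<inter> B"] by (auto simp: le_infI1)
      moreover have "insert a A \<subseteq> points H"
        using assms(3) by (auto simp: H_def)
      ultimately show ?case
        using contractible_remove_iff[OF H, of "insert a A" a] by simp
    next
      case (insert x F)
      let ?W = "insert a A \<union> insert x F"
      have W: "?W \<subseteq> points H"
        using insert.prems assms(3) by (auto simp: H_def)
      have fin: "finite ?W"
        using W assms(2) by (auto simp: H_def intro: finite_subset)
      have "contractible (induced H (?W \<inter> neighbours H x))"
      proof (rule contractible_cone[OF H, of _ a])
        show "a \<in> neighbours H w" if "w \<in> ?W \<inter> neighbours H x" "w \<noteq> a" for w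
          using that nx(1)[of x] insert.prems na neighbours_sym[of w H a] assms(3)
          by (auto simp: H_def)
      qed (use fin W nx[of x] insert.prems in auto)
      moreover have "?W - {x} = insert a A \<union> F"
        using insert a assms(3) by auto
      ultimately show ?case
        using contractible_remove_iff[OF H W, of x] insert by auto
    qed
    from this[of "B - A"] show ?thesis
      using assms(2,3) induced_points[OF H] by (auto simp: H_def Un_Diff)
  qed
  ultimately show ?thesis
    by (rule contractible_contr_trans.trans_step)
qed


section \<open>Zero-spheres and one-spheres\<close>

lemma zero_sphere_map_graph:
  "zero_sphere G \<Longrightarrow> inj_on f (points G) \<Longrightarrow> zero_sphere (map_graph f G)"
  unfolding zero_sphere_def map_graph_def
  by (elim exE conjE, intro exI conjI[rotated]) (auto simp: inj_on_def)

lemma one_sphere_map_graph: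
  assumes "one_sphere G" "inj_on f (points G)"
  shows "one_sphere (map_graph f G)"
  unfolding one_sphere_def
proof (intro conjI ballI)
  fix y assume "y \<in> points (map_graph f G)"
  then obtain x where "x \<in> points G" "y = f x"
    by auto
  then show "zero_sphere (rim (map_graph f G) y)"
    using assms inj_on_subset[OF assms(2) neighbours_subset[of G x]]
    by (simp add: one_sphere_def rim_map_graph zero_sphere_map_graph)
qed (use assms in \<open>auto simp: one_sphere_def digital_space_map_graph connected_space_map_graph\<close>)

text \<open>A maximal contractible proper subspace that is joined to its complement by exactly two
  edges exhausts \<open>S - v\<close>: any other point it is joined to could be added to it, unless that
  point closes up the whole sphere.\<close>

lemma contractible_one_sphere_del_point:
  fixes S :: "'a::infinite dgraph"
  assumes S: "one_sphere S" and v: "v \<in> points S"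
  shows "contractible (del_point S v)"
proof -
  have ds: "digital_space S" and fin: "finite (points S)" and con: "connected_space S"
    using S by (auto simp: one_sphere_def)
  have nb: "\<exists>a b. a \<noteq> b \<and> neighbours S x = {a, b}" if x: "x \<in> points S" for x
  proof -
    obtain a b where "a \<noteq> b" "rim S x = ({a, b}, {})"
      using S x unfolding one_sphere_def zero_sphere_def by blast
    then show ?thesis
      using points_rim[of S x] by auto
  qed
  \<comment> \<open>The edges leaving \<open>W\<close>, as ordered pairs, so that two edges ending
    in the same outside point are counted twice.\<close>
  define cut where "cut W = {(w, x). w \<in> W \<and> x \<in> neighbours S w \<and> x \<notin> W}" for W
  define good where "good W \<longleftrightarrow> W \<subseteq> points S - {v} \<and> contractible (induced S W) \<and>
    (\<exists>p q. p \<noteq> q \<and> cut W = {p, q})" for W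
  obtain w0 where w0: "w0 \<in> neighbours S v"
    using nb[OF v] by blast
  have "w0 \<in> points S" "w0 \<noteq> v"
    using w0 not_self_neighbour[OF ds] neighbours_subset[of S v] by auto
  moreover obtain a b where "a \<noteq> b" "neighbours S w0 = {a, b}"
    using nb[of w0] \<open>w0 \<in> points S\<close> by blast
  moreover from this have "cut {w0} = {(w0, a), (w0, b)}"
    using not_self_neighbour[OF ds, of w0] by (auto simp: cut_def)
  ultimately have "good {w0}"
    unfolding good_def using contractible_singleton[OF ds] by blast
  moreover have "finite {W. good W}"
    by (rule finite_subset[of _ "Pow (points S)"]) (use fin in \<open>auto simp: good_def\<close>)
  ultimately obtain W where W: "good W" and max: "\<And>V. good V \<Longrightarrow> W \<subseteq> V \<Longrightarrow> V = W"
    using finite_has_maximal[of "{W. good W}"] by blast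
  obtain p q where pq: "p \<noteq> q" "cut W = {p, q}"
    using W by (auto simp: good_def)
  have WS: "W \<subseteq> points S" "v \<notin> W"
    using W by (auto simp: good_def)
  \<comment> \<open>Maximality: an edge leaving \<open>W\<close> towards a point other than
    \<open>v\<close> would allow \<open>W\<close> to grow.\<close>
  have target: "x = v" if wx: "(w, x) \<in> cut W" for w x
  proof (rule ccontr)
    assume "x \<noteq> v"
    have w: "w \<in> W" "x \<in> neighbours S w" "x \<notin> W" "x \<in> points S"
      using wx neighbours_subset[of S w] by (auto simp: cut_def)
    then have wx': "w \<in> neighbours S x"
      using neighbours_sym[of w S x] WS by blast
    obtain c d where "c \<noteq> d" "neighbours S x = {c, d}"
      using nb[OF w(4)] by blast
    with wx' have "\<exists>y. y \<noteq> w \<and> neighbours S x = {w, y}"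
      by (cases "w = c") (auto simp: insert_commute)
    then obtain y where y: "y \<noteq> w" "neighbours S x = {w, y}"
      by blast
    have y': "y \<in> points S" "y \<noteq> x" "x \<in> neighbours S y"
      using y(2) neighbours_subset[of S x] not_self_neighbour[OF ds, of x]
        neighbours_sym[OF w(4), of y] by auto
    show False
    proof (cases "y \<in> W")
      case True
      \<comment> \<open>Here both leaving edges end in \<open>x\<close>, so \<open>W\<close>
        together with \<open>x\<close> is closed under edges. By connectedness it is everything,
        although it misses \<open>v\<close>.\<close>
      have "{(w, x), (y, x)} \<subseteq> {p, q}"
        using wx True w(3) y'(3) pq(2) by (auto simp: cut_def)
      then have cut: "cut W = {(w, x), (y, x)}"
        using pq y(1) by auto
      have "edge_closed S (insert x W)"
      proof (rule edge_closedI)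
        fix c d
        assume cd: "{c, d} \<in> edges S" "c \<in> insert x W"
        then have d: "d \<in> neighbours S c"
          using edge_points[OF ds cd(1)] by (simp add: neighbours_def insert_commute)
        show "d \<in> insert x W"
        proof (cases "c = x")
          case True
          then show ?thesis
            using d y(2) w(1) \<open>y \<in> W\<close> by auto
        next
          case False
          then have "d \<in> W \<or> (c, d) \<in> cut W"
            using d cd(2) by (auto simp: cut_def)
          then show ?thesis
            using cut by auto
        qed
      qed
      from connected_spaceD[OF con this, of x] show False
        using w(4) v \<open>x \<noteq> v\<close> WS(2) by blast
    next
      case False
      \<comment> \<open>Now \<open>x\<close> is joined to \<open>W\<close> only through
        \<open>w\<close>. Adding it keeps contractibility, and the leaving edge to \<open>x\<close>
        is exchanged for the one from \<open>x\<close> to \<open>y\<close>, so there are still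
        two.\<close>
      have nW: "insert x W \<inter> neighbours S x = {w}"
        using y(2) w(1) False y'(2) not_self_neighbour[OF ds, of x] by auto
      have "contractible (induced S (insert x W))"
        using contractible_remove_iff[OF ds, of "insert x W" x] nW w contractible_singleton[OF ds, of w]
          W WS by (auto simp: good_def)
      moreover have "\<exists>p q. p \<noteq> q \<and> cut (insert x W) = {p, q}"
      proof -
        have "c = w" if c: "c \<in> W" "x \<in> neighbours S c" for c
        proof -
          have "c \<in> neighbours S x"
            using c neighbours_sym[OF w(4), of c] WS by auto
          then show ?thesis
            using c y(2) False by auto
        qed
        then have "cut (insert x W) = insert (x, y) (cut W - {(w, x)})"
          using y(1) w(1) False y'(2) by (auto simp: cut_def y(2))
        moreover obtain r where r: "cut W = {(w, x), r}" "r \<noteq> (w, x)"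
          using pq wx that[of p] that[of q] by (cases "p = (w, x)") (simp_all add: insert_commute)
        moreover from r(1) have "r \<noteq> (x, y)"
          using w(3) by (auto simp: cut_def)
        ultimately have "(x, y) \<noteq> r \<and> cut (insert x W) = {(x, y), r}"
          by auto
        then show ?thesis
          by blast
      qed
      ultimately have "good (insert x W)"
        using w(4) WS \<open>x \<noteq> v\<close> unfolding good_def by blast
      then show False
        using max[of "insert x W"] w(3) by blast
    qed
  qed
  \<comment> \<open>Both leaving edges end in \<open>v\<close> and use up its two neighbours. Hence
    \<open>W\<close> with \<open>v\<close> is closed under edges and is the whole sphere.\<close>
  have "snd p = v" "snd q = v"
    using target[of "fst p" "snd p"] target[of "fst q" "snd q"] by (simp_all add: pq(2))
  then obtain w w' where ww: "p = (w, v)" "q = (w', v)" "w \<noteq> w'"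
    using pq(1) by (metis prod.collapse)
  then have "w \<in> W" "w' \<in> W" "v \<in> neighbours S w" "v \<in> neighbours S w'"
    using pq(2) by (auto simp: cut_def)
  moreover from this have "w \<in> neighbours S v" "w' \<in> neighbours S v"
    using neighbours_sym[OF v, of w] neighbours_sym[OF v, of w'] WS by auto
  ultimately have nv: "neighbours S v \<subseteq> W"
    using nb[OF v] ww(3) by auto
  have "edge_closed S (insert v W)"
  proof (rule edge_closedI)
    fix c d
    assume cd: "{c, d} \<in> edges S" "c \<in> insert v W"
    then have d: "d \<in> neighbours S c"
      using edge_points[OF ds cd(1)] by (simp add: neighbours_def insert_commute)
    show "d \<in> insert v W"
      using d nv cd(2) target[of c d] by (auto simp: cut_def)
  qed
  from connected_spaceD[OF con this, of v] have "points S - {v} = W"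
    using v WS by auto
  then show ?thesis
    using W by (simp add: del_point_def good_def)
qed


section \<open>Spheres as unions of two cells\<close>

text \<open>In dimension 0 the 0-spheres play the role of the closed manifolds, so that rims in a
  1-sphere need no separate treatment.\<close>

definition manifold :: "nat \<Rightarrow> 'a::infinite dgraph \<Rightarrow> bool" where
  "manifold n M \<longleftrightarrow> (if n = 0 then zero_sphere M else closed_manifold n M)"

text \<open>A disk sitting in \<open>G\<close>, with boundary \<open>K\<close>. The presentation as
  a manifold without a point is an equality, not an isomorphism, so that rims in \<open>M\<close>
  can be compared directly with rims in \<open>G\<close>; the point \<open>a\<close> need not lie in
  \<open>G\<close>.\<close>

definition cell :: "nat \<Rightarrow> 'a::infinite dgraph \<Rightarrow> 'a set \<Rightarrow> 'a set \<Rightarrow> bool" where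
  "cell n G A K \<longleftrightarrow> contractible (induced G A) \<and>
    (\<exists>M a. manifold n M \<and> a \<in> points M \<and> del_point M a = induced G A \<and> neighbours M a = K)"

text \<open>The space \<open>D # C\<close> seen from inside: two cells whose overlap is their common
  boundary, with no disjoint union and no gluing map.\<close>

definition sphere_split :: "nat \<Rightarrow> 'a::infinite dgraph \<Rightarrow> 'a set \<Rightarrow> 'a set \<Rightarrow> bool" where
  "sphere_split n G A B \<longleftrightarrow> digital_space G \<and> points G = A \<union> B \<and>
    (\<forall>e \<in> edges G. e \<subseteq> A \<or> e \<subseteq> B) \<and> cell n G A (A \<inter> B) \<and> cell n G B (A \<inter> B)"

lemma sphere_split_commute: "sphere_split n G A B \<Longrightarrow> sphere_split n G B A"
  by (auto simp: sphere_split_def Int_commute)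

lemma points_manifold: "manifold n M \<Longrightarrow> points M \<noteq> {}"
  by (cases n) (auto simp: manifold_def zero_sphere_def connected_space_def)

lemma finite_sphere_split: "sphere_split n G A B \<Longrightarrow> finite (points G)"
  using finite_contractible[of "induced G A"] finite_contractible[of "induced G B"]
  by (auto simp: sphere_split_def cell_def Int_absorb1)

section \<open>Spheres, manifolds and cells under renaming of points\<close>

lemma digital_sphere_map_graph:
  fixes f :: "'a::infinite \<Rightarrow> 'a"
  assumes "digital_sphere n G" "inj_on f (points G)"
  shows "digital_sphere n (map_graph f G)"
proof -
  consider "n = 0" | "n = Suc 0" | m where "n = Suc (Suc m)"
    by (metis not0_implies_Suc)
  then show ?thesis
  proof cases
    case 1
    then show ?thesis
      using assms by (simp add: zero_sphere_map_graph)
  next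
    case 2
    then show ?thesis
      using assms by (simp add: one_sphere_map_graph)
  next
    case 3
    \<comment> \<open>From dimension 2 on spheres are defined up to isomorphism, so it suffices to
      compose with \<open>f\<close>; the two disks stay the same.\<close>
    have "isomorphic X (map_graph f G)" if "isomorphic X G" for X :: "('a + 'a) dgraph"
    proof -
      obtain g where g: "inj_on g (points X)" "G = map_graph g X"
        using \<open>isomorphic X G\<close> by (auto simp: isomorphic_def graph_iso_iff)
      then have "graph_iso (f \<circ> g) X (map_graph f G)"
        using assms(2) by (auto simp: graph_iso_iff map_graph_comp comp_inj_on)
      then show ?thesis
        by (auto simp: isomorphic_def)
    qed
    then show ?thesis
      using assms(1) unfolding 3 digital_sphere.simps by blast
  qed
qed

lemma closed_manifold_map_graph:
  fixes f :: "'a::infinite \<Rightarrow> 'a"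
  assumes "closed_manifold n M" "inj_on f (points M)"
  shows "closed_manifold n (map_graph f M)"
proof (cases n)
  case 0
  then show ?thesis
    using assms by simp
next
  case (Suc k)
  have "digital_sphere k (rim (map_graph f M) y)" if y: "y \<in> points (map_graph f M)" for y
  proof -
    obtain x where "x \<in> points M" "y = f x"
      using y by auto
    then show ?thesis
      using assms inj_on_subset[OF assms(2) neighbours_subset[of M x]]
      by (simp add: Suc rim_map_graph digital_sphere_map_graph)
  qed
  then show ?thesis
    using assms by (simp add: Suc digital_space_map_graph connected_space_map_graph)
qed

lemma bounded_manifold_del_point:
  assumes "closed_manifold n M" "a \<in> points M" "connected_space (del_point M a)"
  shows "bounded_manifold n (del_point M a) (neighbours M a)"
  unfolding bounded_manifold.simps
  using assms by (intro conjI exI[of _ M] exI[of _ a] exI[of _ "\<lambda>x. x"])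
    (auto simp: graph_iso_iff map_graph_id)

lemma bounded_manifold_cell:
  assumes "cell (Suc n) G A K"
  shows "bounded_manifold (Suc n) (induced G A) K"
  using assms bounded_manifold_del_point[of "Suc n"] contractible_connected
  by (fastforce simp: cell_def manifold_def simp del: bounded_manifold.simps closed_manifold.simps)

lemma digital_diskI:
  assumes "bounded_manifold (Suc (Suc n)) N B" "contractible N"
  shows "digital_disk (Suc (Suc n)) N"
  unfolding digital_disk.simps using assms by (intro conjI exI)

lemma cell_map_graph:
  fixes G :: "'a::infinite dgraph" and D :: "'a dgraph"
  assumes "bounded_manifold (Suc n) D K" "contractible D" "inj_on g (points D)"
    and ind: "induced G A = map_graph g D"
  shows "cell (Suc n) G A (g ` K)"
proof -
  have con: "contractible (induced G A)"
    using assms contractible_map_graph by simp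
  obtain M :: "'a dgraph" and v f where M: "closed_manifold (Suc n) M" "v \<in> points M"
    and f: "inj_on f (points M - {v})" "D = map_graph f (del_point M v)" "K = f ` neighbours M v"
    using assms(1) unfolding bounded_manifold.simps graph_iso_iff points_rim points_del_point by blast
  have ds: "digital_space M"
    using M(1) by simp
  define h where "h = g \<circ> f"
  have h: "inj_on h (points M - {v})"
    using f assms(3) by (auto simp: h_def intro: comp_inj_on)
  have "finite (h ` (points M - {v}))"
    using finite_contractible[OF con] f(2) by (simp add: ind h_def image_comp)
  then obtain a where a: "a \<notin> h ` (points M - {v})"
    using ex_new_if_finite[OF infinite_UNIV] by blast
  define h' where "h' = h(v := a)"
  have h': "inj_on h' (points M)"
    using h a by (auto simp: h'_def inj_on_def)
  have "del_point (map_graph h' M) a = map_graph h' (del_point M v)"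
    using del_point_map_graph[OF ds h' M(2)] by (simp add: h'_def)
  also have "\<dots> = map_graph h (del_point M v)"
    by (rule map_graph_cong) (use ds in \<open>auto simp: h'_def digital_space_del_point\<close>)
  finally have "del_point (map_graph h' M) a = induced G A"
    by (simp add: ind f(2) map_graph_comp h_def)
  moreover have "neighbours (map_graph h' M) a = g ` K"
  proof -
    have "neighbours (map_graph h' M) a = h' ` neighbours M v"
      using neighbours_map_graph[OF ds h' M(2)] by (simp add: h'_def)
    also have "\<dots> = h ` neighbours M v"
      using not_self_neighbour[OF ds] by (intro image_cong) (auto simp: h'_def)
    finally show ?thesis
      by (simp add: f(3) h_def image_comp)
  qed
  moreover have "a \<in> points (map_graph h' M)"
    using M(2) by (auto simp: h'_def)
  moreover have "manifold (Suc n) (map_graph h' M)"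
    using closed_manifold_map_graph[OF M(1) h'] by (simp add: manifold_def del: closed_manifold.simps)
  ultimately show ?thesis
    unfolding cell_def using con by blast
qed

text \<open>The two sets are the images of \<open>D\<close> and \<open>C\<close>. They carry no
  edges beyond those of the disks because \<open>h\<close> matches edges of the boundaries in both
  directions.\<close>

lemma sphere_split_glue:
  fixes D C G :: "'a::infinite dgraph"
  assumes D: "bounded_manifold (Suc n) D BD" "contractible D" and DB: "BD \<subseteq> points D"
    and C: "bounded_manifold (Suc n) C BC" "contractible C" and CB: "BC \<subseteq> points C"
    and h: "graph_iso h (induced C BC) (induced D BD)"
    and F: "graph_iso F (glue D C BC h) G"
  obtains A B where "sphere_split (Suc n) G A B"
proof -
  let ?c = "glue_incl BC h"
  have dsD: "digital_space D" and dsC: "digital_space C"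
    using D(2) C(2) by (simp_all only: digital_space_contractible)
  have hinj: "inj_on h BC" and hBC: "h ` BC = BD"
    and hE: "{e \<in> edges D. e \<subseteq> BD} = (\<lambda>e. h ` e) ` {e \<in> edges C. e \<subseteq> BC}"
    using h DB CB by (auto simp: graph_iso_iff induced_def map_graph_def Int_absorb1)
  define f1 where "f1 = F \<circ> Inl"
  define f2 where "f2 = F \<circ> ?c"
  have Finj: "inj_on F (Inl ` points D \<union> ?c ` points C)"
    and G: "points G = f1 ` points D \<union> f2 ` points C"
      "edges G = (\<lambda>e. f1 ` e) ` edges D \<union> (\<lambda>e. f2 ` e) ` edges C"
    using F by (auto simp: graph_iso_iff glue_def map_graph_def f1_def f2_def image_Un image_comp comp_def)
  have cinj: "inj_on ?c (points C)"
    using hinj by (auto simp: inj_on_def glue_incl_def)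
  have inj1: "inj_on f1 (points D)"
    unfolding f1_def by (rule comp_inj_on) (auto intro: inj_on_subset[OF Finj])
  have inj2: "inj_on f2 (points C)"
    unfolding f2_def by (rule comp_inj_on[OF cinj]) (auto intro: inj_on_subset[OF Finj])
  have f12: "f2 x = f1 (h x)" if "x \<in> BC" for x
    using that by (simp add: f1_def f2_def glue_incl_def)
  then have B12: "f2 ` BC = f1 ` BD"
    using hBC by force
  let ?A = "f1 ` points D" and ?B = "f2 ` points C"
  \<comment> \<open>The gluing identifies points of \<open>D\<close> and \<open>C\<close> only along
    their boundaries.\<close>
  have meet: "x \<in> BD \<and> y \<in> BC" if "x \<in> points D" "y \<in> points C" "f1 x = f2 y" for x y
  proof -
    have "Inl x = ?c y"
      using inj_onD[OF Finj, of "Inl x" "?c y"] that by (auto simp: f1_def f2_def)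
    then show ?thesis
      using hBC by (auto simp: glue_incl_def split: if_splits)
  qed
  have AB: "?A \<inter> ?B = f1 ` BD"
  proof
    show "?A \<inter> ?B \<subseteq> f1 ` BD"
      using meet by blast
    show "f1 ` BD \<subseteq> ?A \<inter> ?B"
      using DB CB B12 by blast
  qed
  have dsG: "digital_space G"
    unfolding digital_space_def
  proof (intro conjI ballI)
    show "countable (points G)"
      using dsD dsC by (simp add: G digital_space_def)
    fix e assume "e \<in> edges G"
    then consider "e \<in> edges (map_graph f1 D)" | "e \<in> edges (map_graph f2 C)"
      unfolding G map_graph_def snd_conv by blast
    then show "\<exists>u v. u \<in> points G \<and> v \<in> points G \<and> u \<noteq> v \<and> e = {u, v}"
    proof cases
      case 1
      then show ?thesis
        by (rule edgeE[OF digital_space_map_graph[OF dsD inj1]]) (auto simp: G(1))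
    next
      case 2
      then show ?thesis
        by (rule edgeE[OF digital_space_map_graph[OF dsC inj2]]) (auto simp: G(1))
    qed
  qed
  have restrict: "{e \<in> E. e \<subseteq> X} = E'" if "E' \<subseteq> Pow X" "E = E' \<union> F" "F \<inter> Pow X \<subseteq> E'" for E E' F X
    using that by blast
  have fh: "f2 ` e = f1 ` h ` e" if "e \<subseteq> BC" for e
    unfolding image_image using that f12 by (intro image_cong refl) blast
  have indA: "induced G ?A = map_graph f1 D"
  proof (rule prod_eqI)
    \<comment> \<open>An edge coming from \<open>C\<close> with both ends in the image of
      \<open>D\<close> lies in \<open>BC\<close>, so \<open>h\<close> makes it the image of an edge
      of \<open>D\<close> as well.\<close>
    have "f2 ` e \<in> (\<lambda>e. f1 ` e) ` edges D" if e: "e \<in> edges C" "f2 ` e \<subseteq> ?A" for e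
    proof -
      have eBC: "e \<subseteq> BC"
      proof
        fix y assume "y \<in> e"
        moreover from this obtain x where "x \<in> points D" "f2 y = f1 x"
          using e(2) by blast
        ultimately show "y \<in> BC"
          using meet[of x y] edge_subset[OF dsC e(1)] by auto
      qed
      then have "h ` e \<in> {e \<in> edges D. e \<subseteq> BD}"
        unfolding hE using e(1) by blast
      then show ?thesis
        unfolding fh[OF eBC] by blast
    qed
    then have F: "(\<lambda>e. f2 ` e) ` edges C \<inter> Pow ?A \<subseteq> edges (map_graph f1 D)"
      by (auto simp: map_graph_def)
    have P: "edges (map_graph f1 D) \<subseteq> Pow ?A"
      using edge_subset[OF digital_space_map_graph[OF dsD inj1]] by auto
    have E: "edges G = edges (map_graph f1 D) \<union> (\<lambda>e. f2 ` e) ` edges C"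
      by (simp add: G(2) map_graph_def)
    show "edges (induced G ?A) = edges (map_graph f1 D)"
      unfolding induced_def snd_conv by (rule restrict[OF P E F])
  qed (auto simp: G(1))
  have indB: "induced G ?B = map_graph f2 C"
  proof (rule prod_eqI)
    have "f1 ` e \<in> (\<lambda>e. f2 ` e) ` edges C" if e: "e \<in> edges D" "f1 ` e \<subseteq> ?B" for e
    proof -
      have "e \<subseteq> BD"
      proof
        fix x assume "x \<in> e"
        moreover from this obtain y where "y \<in> points C" "f1 x = f2 y"
          using e(2) by blast
        ultimately show "x \<in> BD"
          using meet[of x y] edge_subset[OF dsD e(1)] by auto
      qed
      then have "e \<in> (\<lambda>e. h ` e) ` {e \<in> edges C. e \<subseteq> BC}"
        unfolding hE[symmetric] using e(1) by blast
      then obtain e' where e': "e' \<in> edges C" "e' \<subseteq> BC" "e = h ` e'"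
        by blast
      have "f1 ` e = f2 ` e'"
        unfolding e'(3) by (rule fh[OF e'(2), symmetric])
      with e'(1) show ?thesis
        by blast
    qed
    then have F: "(\<lambda>e. f1 ` e) ` edges D \<inter> Pow ?B \<subseteq> edges (map_graph f2 C)"
      by (auto simp: map_graph_def)
    have P: "edges (map_graph f2 C) \<subseteq> Pow ?B"
      using edge_subset[OF digital_space_map_graph[OF dsC inj2]] by auto
    have E: "edges G = edges (map_graph f2 C) \<union> (\<lambda>e. f1 ` e) ` edges D"
      by (simp add: G(2) map_graph_def Un_commute)
    show "edges (induced G ?B) = edges (map_graph f2 C)"
      unfolding induced_def snd_conv by (rule restrict[OF P E F])
  qed (auto simp: G(1))
  have "cell (Suc n) G ?A (?A \<inter> ?B)"
    unfolding AB using D inj1 indA by (rule cell_map_graph)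
  moreover have "cell (Suc n) G ?B (?A \<inter> ?B)"
    unfolding AB B12[symmetric] using C inj2 indB by (rule cell_map_graph)
  moreover have "\<forall>e \<in> edges G. e \<subseteq> ?A \<or> e \<subseteq> ?B"
    by (simp add: G(2) ball_Un image_mono edge_subset[OF dsD] edge_subset[OF dsC])
  ultimately show ?thesis
    using that dsG G(1) unfolding sphere_split_def by blast
qed

lemma digital_sphere_split:
  fixes S :: "'a::infinite dgraph"
  assumes "digital_sphere (Suc (Suc n)) S"
  obtains A B where "sphere_split (Suc (Suc n)) S A B"
proof -
  have sub: "B \<subseteq> points N" if bm: "bounded_manifold (Suc (Suc n)) N B" for N :: "'a dgraph" and B
  proof -
    obtain M :: "'a dgraph" and v f where "digital_space M" "graph_iso f (del_point M v) N" "B = f ` neighbours M v"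
      using bm unfolding bounded_manifold.simps closed_manifold.simps points_rim by blast
    then show ?thesis
      using neighbours_subset[of M v] not_self_neighbour[of M v] by (auto simp: graph_iso_iff)
  qed
  from assms obtain D C :: "'a dgraph" and BD BC h F where
      "bounded_manifold (Suc (Suc n)) D BD" "contractible D"
      "bounded_manifold (Suc (Suc n)) C BC" "contractible C"
      "graph_iso h (induced C BC) (induced D BD)" "graph_iso F (glue D C BC h) S"
    unfolding digital_sphere.simps digital_disk.simps isomorphic_def by blast
  then show ?thesis
    using sphere_split_glue[of "Suc n" D BD C BC h F S] sub that by blast
qed

text \<open>In dimension 1 spheres are the finite closed manifolds, and the splitting supplies
  finiteness. Above that, the two halves are glued along the identity of their overlap.\<close>

lemma digital_sphere_sphere_split:
  assumes "sphere_split (Suc n) S A B" "closed_manifold (Suc n) S"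
  shows "digital_sphere (Suc n) S"
proof (cases n)
  case 0
  then show ?thesis
    using assms finite_sphere_split[OF assms(1)] by (simp add: one_sphere_def)
next
  case (Suc m)
  have S: "points S = A \<union> B" "\<forall>e \<in> edges S. e \<subseteq> A \<or> e \<subseteq> B"
    and A: "cell (Suc n) S A (A \<inter> B)" and B: "cell (Suc n) S B (A \<inter> B)"
    using assms(1) by (auto simp: sphere_split_def)
  let ?K = "A \<inter> B"
  let ?D = "induced S A" and ?C = "induced S B"
  \<comment> \<open>Folding the two copies in the disjoint union back onto \<open>S\<close> is the
    required isomorphism.\<close>
  let ?F = "case_sum (\<lambda>x. x) (\<lambda>x. x) :: 'a + 'a \<Rightarrow> 'a"
  have incl: "?F (glue_incl ?K (\<lambda>x. x) x) = x" for x
    by (simp add: glue_incl_def)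
  have "induced ?C ?K = induced ?D ?K"
    by (auto simp: induced_induced intro: arg_cong2[where f = induced])
  then have h: "graph_iso (\<lambda>x. x) (induced ?C ?K) (induced ?D ?K)"
    by (simp add: graph_iso_iff map_graph_id)
  have "inj_on ?F (points (glue ?D ?C ?K (\<lambda>x. x)))"
    using S(1) by (auto simp: glue_def inj_on_def glue_incl_def)
  moreover have "map_graph ?F (glue ?D ?C ?K (\<lambda>x. x)) = S"
    using S by (auto simp: map_graph_def glue_def image_Un image_image incl induced_def prod_eq_iff)
  ultimately have iso: "isomorphic (glue ?D ?C ?K (\<lambda>x. x)) S"
    by (auto simp: isomorphic_def graph_iso_iff)
  have bD: "bounded_manifold (Suc (Suc m)) ?D ?K" and bC: "bounded_manifold (Suc (Suc m)) ?C ?K"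
    using bounded_manifold_cell[OF A] bounded_manifold_cell[OF B] by (simp_all only: Suc)
  have disk: "digital_disk (Suc (Suc m)) ?D" "digital_disk (Suc (Suc m)) ?C"
    using digital_diskI[OF bD] digital_diskI[OF bC] A B by (simp_all only: cell_def)
  show ?thesis
    unfolding Suc digital_sphere.simps
    by (rule exI[of _ ?D], rule exI[of _ ?K], rule exI[of _ ?C], rule exI[of _ ?K],
        rule exI[of _ "\<lambda>x. x"]) (intro conjI disk bD bC h iso)
qed


section \<open>Deleting a point from a sphere\<close>

text \<open>A 0-sphere without a point is a single point with empty boundary, so the two cells are
  distinct points and no edge can run between them.\<close>

lemma sphere_split_0:
  fixes G :: "'a::infinite dgraph"
  assumes "sphere_split 0 G A B"
  shows "zero_sphere G"
proof -
  have one: "\<exists>x. X = {x} \<and> A \<inter> B = {}" if X: "cell 0 G X (A \<inter> B)" "X \<subseteq> points G" for X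
  proof -
    obtain M :: "'a dgraph" and a where M: "zero_sphere M" "a \<in> points M"
        "del_point M a = induced G X" "neighbours M a = A \<inter> B"
      using X(1) unfolding cell_def manifold_def by auto
    then obtain c d where cd: "c \<noteq> d" "M = ({c, d}, {})"
      by (auto simp: zero_sphere_def)
    have "X = points M - {a}"
      using arg_cong[OF M(3), of points] X(2) by auto
    then show ?thesis
      using M(2,4) cd by (auto simp: neighbours_def)
  qed
  have G: "digital_space G" "points G = A \<union> B" "\<forall>e \<in> edges G. e \<subseteq> A \<or> e \<subseteq> B"
    using assms by (auto simp: sphere_split_def)
  obtain a b where ab: "A = {a}" "B = {b}" "a \<noteq> b"
    using one[of A] one[of B] assms by (auto simp: sphere_split_def)
  have "edges G = {}"
  proof (rule equals0I)
    fix e assume e: "e \<in> edges G"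
    then obtain u w where "u \<noteq> w" "e = {u, w}"
      by (rule edgeE[OF G(1)])
    then show False
      using G(3) e ab by auto
  qed
  then have "G = ({a, b}, {})"
    using G(2) ab by (auto simp: prod_eq_iff)
  then show ?thesis
    unfolding zero_sphere_def using ab(3) by blast
qed

text \<open>The rim of \<open>x\<close> in \<open>M\<close> is a sphere, and deleting
  \<open>a\<close> from it gives the rim of \<open>x\<close> within \<open>A\<close>. Off
  \<open>K\<close> the point \<open>a\<close> is not in that rim; on \<open>K\<close> it is, and the
  rim in \<open>M\<close> serves as \<open>R\<close>.\<close>

lemma cell_link:
  assumes "digital_space G" "A \<subseteq> points G" "cell (Suc n) G A K" "x \<in> A"
  shows "x \<notin> K \<Longrightarrow> digital_sphere n (induced G (A \<inter> neighbours G x))"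
    and "x \<in> K \<Longrightarrow> \<exists>R a. digital_sphere n R \<and> a \<in> points R \<and>
      del_point R a = induced G (A \<inter> neighbours G x) \<and> neighbours R a = K \<inter> neighbours G x"
proof -
  obtain M a where M: "closed_manifold (Suc n) M" "a \<in> points M"
    and del: "del_point M a = induced G A" and K: "neighbours M a = K"
    using assms(3) by (auto simp: cell_def manifold_def simp del: closed_manifold.simps)
  have ds: "digital_space M" and sph: "\<And>y. y \<in> points M \<Longrightarrow> digital_sphere n (rim M y)"
    using M(1) by auto
  have "points M - {a} = A"
    using arg_cong[OF del, of points] assms(2) by auto
  then have x: "x \<in> points M" "x \<noteq> a" and KA: "K \<subseteq> A"
    using assms(4) K neighbours_subset[of M a] not_self_neighbour[OF ds, of a] by auto
  have link: "del_point (rim M x) a = induced G (A \<inter> neighbours G x)"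
    using rim_del_point[OF ds x(2)] rim_induced[OF assms(4), of G] by (simp add: del)
  show "digital_sphere n (induced G (A \<inter> neighbours G x))" if "x \<notin> K"
  proof -
    have "a \<notin> neighbours M x"
      using that K neighbours_sym[OF x(1) M(2)] by simp
    then have "del_point (rim M x) a = rim M x"
      using del_point_rim[OF ds, of x a] by (simp add: rim_def)
    then show ?thesis
      using sph[OF x(1)] link by simp
  qed
  show "\<exists>R a. digital_sphere n R \<and> a \<in> points R \<and>
      del_point R a = induced G (A \<inter> neighbours G x) \<and> neighbours R a = K \<inter> neighbours G x" if "x \<in> K"
  proof -
    have a: "a \<in> neighbours M x"
      using that K neighbours_sym[OF x(1) M(2)] by simp
    have "neighbours M x - {a} = A \<inter> neighbours G x"
      using arg_cong[OF link, of points] assms(2) by auto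
    then have "neighbours M x \<inter> K = K \<inter> neighbours G x"
      using KA K not_self_neighbour[OF ds, of a] by auto
    then have "neighbours (rim M x) a = K \<inter> neighbours G x"
      unfolding rim_def neighbours_induced[OF a] K .
    then show ?thesis
      using sph[OF x(1)] a link by (intro exI[of _ "rim M x"] exI[of _ a]) simp
  qed
qed

text \<open>\<open>K\<close> carries the rim of \<open>a\<close> in \<open>M\<close>; as
  \<open>a\<close> is not in its own rim, this rim lies in the part that \<open>M\<close> shares
  with \<open>G\<close>.\<close>

lemma cell_boundary:
  assumes "digital_space G" "A \<subseteq> points G" "cell (Suc n) G A K"
  shows "digital_sphere n (induced G K)"
proof -
  obtain M a where M: "closed_manifold (Suc n) M" "a \<in> points M"
    and del: "del_point M a = induced G A" and K: "neighbours M a = K"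
    using assms(3) by (auto simp: cell_def manifold_def simp del: closed_manifold.simps)
  have ds: "digital_space M"
    using M(1) by simp
  have "points M - {a} = A"
    using arg_cong[OF del, of points] assms(2) by auto
  then have KA: "K \<subseteq> A" "a \<notin> K"
    using K neighbours_subset[of M a] not_self_neighbour[OF ds, of a] by auto
  have "rim M a = induced (del_point M a) K"
    using KA(2) by (simp add: rim_def K del_point_eq_induced[OF ds] induced_induced Int_absorb1)
  also have "\<dots> = induced G K"
    using KA(1) by (simp add: del induced_induced Int_absorb1)
  finally have "rim M a = induced G K" .
  moreover have "digital_sphere n (rim M a)"
    using M by simp
  ultimately show ?thesis
    by simp
qed

text \<open>The first three hypotheses are the induction hypothesis in dimension \<open>n\<close>.
  The overlap is a sphere, hence nonempty, which makes the union connected.\<close>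

lemma closed_manifold_sphere_split:
  fixes G :: "'a::infinite dgraph"
  assumes split: "\<And>(H :: 'a dgraph) A B. sphere_split n H A B \<Longrightarrow> digital_sphere n H"
    and manifold: "\<And>S :: 'a dgraph. digital_sphere n S \<Longrightarrow> manifold n S"
    and del: "\<And>(S :: 'a dgraph) v. digital_sphere n S \<Longrightarrow> v \<in> points S \<Longrightarrow> contractible (del_point S v)"
    and G: "sphere_split (Suc n) G A B"
  shows "closed_manifold (Suc n) G"
proof -
  have ds: "digital_space G" and pts: "points G = A \<union> B"
    and A: "cell (Suc n) G A (A \<inter> B)" and B: "cell (Suc n) G B (A \<inter> B)"
    using G by (auto simp: sphere_split_def)
  have "digital_sphere n (induced G (A \<inter> B))"
    by (rule cell_boundary[OF ds _ A]) (use pts in auto)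
  then have "A \<inter> B \<noteq> {}"
    using points_manifold[OF manifold] by fastforce
  moreover have "contractible (induced G A)" "contractible (induced G B)"
    using A B by (simp_all only: cell_def)
  ultimately have con: "connected_space G"
    using connected_space_Un[OF _ _ pts] contractible_connected by blast
  \<comment> \<open>The splitting is left variable here so that exchanging the two cells covers the
    points outside \<open>A\<close> as well.\<close>
  have rim: "digital_sphere n (rim G x)"
    if spl: "sphere_split (Suc n) G A' B'" and x: "x \<in> A' - B'" for x A' B'
  proof -
    have pts': "points G = A' \<union> B'" and cr: "\<And>e. e \<in> edges G \<Longrightarrow> e \<subseteq> A' \<or> e \<subseteq> B'"
      and A': "cell (Suc n) G A' (A' \<inter> B')"
      using spl by (auto simp: sphere_split_def)
    have "neighbours G x \<subseteq> A'"
      using cr x by (fastforce simp: neighbours_def)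
    moreover have "digital_sphere n (induced G (A' \<inter> neighbours G x))"
      using cell_link(1)[OF ds _ A', of x] x pts' by auto
    ultimately show ?thesis
      by (simp add: rim_def Int_absorb1)
  qed
  have bd: "digital_sphere n (rim G x)" if x: "x \<in> A \<inter> B" for x
  proof (rule split)
    let ?N = "neighbours G x"
    have ds': "digital_space (rim G x)"
      using ds by (rule digital_space_rim)
    \<comment> \<open>The sphere \<open>R\<close> without \<open>a\<close> is the rim of
      \<open>x\<close> within one half. By \<open>manifold\<close> and \<open>del\<close> it is a
      cell of dimension \<open>n\<close>, so the two halves split the rim of
      \<open>x\<close>.\<close>
    have link: "cell n (rim G x) (C \<inter> ?N) ((A \<inter> ?N) \<inter> (B \<inter> ?N))"
      if C: "cell (Suc n) G C (A \<inter> B)" "C \<subseteq> points G" "x \<in> C" for C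
    proof -
      obtain R a where R: "digital_sphere n R" "a \<in> points R"
          "del_point R a = induced G (C \<inter> ?N)" "neighbours R a = (A \<inter> B) \<inter> ?N"
        using cell_link(2)[OF ds C(2,1,3) x] by blast
      have "induced (rim G x) (C \<inter> ?N) = induced G (C \<inter> ?N)"
        by (simp add: rim_def induced_induced Int_left_commute)
      moreover have "(A \<inter> ?N) \<inter> (B \<inter> ?N) = (A \<inter> B) \<inter> ?N"
        by blast
      ultimately show ?thesis
        unfolding cell_def using R manifold[OF R(1)] del[OF R(1,2)] by metis
    qed
    have "points (rim G x) = (A \<inter> ?N) \<union> (B \<inter> ?N)"
      using pts neighbours_subset[of G x] by auto
    moreover have "\<forall>e \<in> edges (rim G x). e \<subseteq> A \<inter> ?N \<or> e \<subseteq> B \<inter> ?N"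
      using G by (auto simp: sphere_split_def rim_def)
    moreover have "cell n (rim G x) (A \<inter> ?N) ((A \<inter> ?N) \<inter> (B \<inter> ?N))"
      by (rule link[OF A]) (use pts x in auto)
    moreover have "cell n (rim G x) (B \<inter> ?N) ((A \<inter> ?N) \<inter> (B \<inter> ?N))"
      by (rule link[OF B]) (use pts x in auto)
    ultimately show "sphere_split n (rim G x) (A \<inter> ?N) (B \<inter> ?N)"
      unfolding sphere_split_def using ds' by blast
  qed
  have "digital_sphere n (rim G x)" if "x \<in> points G" for x
    using that pts bd[of x] rim[OF G, of x] rim[OF sphere_split_commute[OF G], of x] by blast
  then show ?thesis
    using ds con by simp
qed

lemma contractible_del_point_boundary:
  fixes S :: "'a::infinite dgraph"
  assumes del: "\<And>(S :: 'a dgraph) v. digital_sphere n S \<Longrightarrow> v \<in> points S \<Longrightarrow> contractible (del_point S v)"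
    and S: "sphere_split (Suc n) S A B" and v: "v \<in> A \<inter> B"
  shows "contractible (del_point S v)"
proof -
  have ds: "digital_space S" and pts: "points S = A \<union> B"
    and A: "cell (Suc n) S A (A \<inter> B)" and B: "cell (Suc n) S B (A \<inter> B)"
    using S by (auto simp: sphere_split_def)
  \<comment> \<open>Within one half, the rim of \<open>v\<close> is an \<open>n\<close>-sphere
    without a point, hence contractible by \<open>del\<close>, so \<open>v\<close> can be removed
    from that half.\<close>
  have sub: "contractible (induced S (C - {v}))"
    if C: "cell (Suc n) S C (A \<inter> B)" "C \<subseteq> points S" "v \<in> C" for C
  proof -
    obtain R a where R: "digital_sphere n R" "a \<in> points R"
        "del_point R a = induced S (C \<inter> neighbours S v)"
      using cell_link(2)[OF ds C(2,1,3) v] by blast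
    have "contractible (induced S (C \<inter> neighbours S v))"
      using del[OF R(1,2)] R(3) by simp
    from contractible_remove_iff[OF ds C(2,3) this] show ?thesis
      using C(1) by (simp add: cell_def)
  qed
  \<comment> \<open>The overlap is an \<open>n\<close>-sphere through \<open>v\<close>, so
    \<open>del\<close> applies to it too and yields the contractible intersection that
    \<open>contractible_Un\<close> asks for.\<close>
  have "digital_sphere n (induced S (A \<inter> B))"
    by (rule cell_boundary[OF ds _ A]) (use pts in auto)
  from del[OF this, of v] have "contractible (induced S (A \<inter> B - {v}))"
    using v pts by (simp add: del_point_induced[OF ds])
  moreover have "contractible (induced S (A - {v}))" "contractible (induced S (B - {v}))"
    using sub[OF A] sub[OF B] pts v by auto
  moreover have "induced (del_point S v) (C - {v}) = induced S (C - {v})" for C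
    by (simp add: del_point_eq_induced[OF ds] induced_induced Diff_eq Int_left_commute Int_commute)
  moreover have "(A - {v}) \<inter> (B - {v}) = A \<inter> B - {v}"
    by blast
  moreover have "e \<subseteq> A - {v} \<or> e \<subseteq> B - {v}" if "e \<in> edges (del_point S v)" for e
    using that S by (auto simp: sphere_split_def del_point_def)
  moreover have "points (del_point S v) = (A - {v}) \<union> (B - {v})"
    using pts by auto
  ultimately show ?thesis
    using contractible_Un[of "del_point S v" "A - {v}" "B - {v}"] digital_space_del_point[OF ds]
      finite_sphere_split[OF S] by (simp add: pts)
qed

lemma contractible_del_point_transfer:
  fixes S :: "'a::infinite dgraph"
  assumes del: "\<And>(S :: 'a dgraph) v. digital_sphere n S \<Longrightarrow> v \<in> points S \<Longrightarrow> contractible (del_point S v)"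
    and S: "closed_manifold (Suc n) S" and v: "v \<in> points S" "contractible (del_point S v)"
    and w: "w \<in> points S"
  shows "contractible (del_point S w)"
proof -
  have ds: "digital_space S"
    using S by simp
  \<comment> \<open>The rim of \<open>y\<close> in \<open>S - x\<close> is the sphere around
    \<open>y\<close> without \<open>x\<close>. The right-hand side is symmetric in \<open>x\<close>
    and \<open>y\<close>, so the property passes along edges.\<close>
  have step: "contractible (del_point S x) \<longleftrightarrow> contractible (induced S (points S - {x} - {y}))"
    if xy: "{x, y} \<in> edges S" for x y
  proof -
    have p: "x \<in> points S" "y \<in> points S" "x \<noteq> y"
      using edge_points[OF ds xy] by auto
    have "x \<in> neighbours S y"
      using p xy by (simp add: neighbours_def)
    moreover have "digital_sphere n (rim S y)"
      using S p by simp
    ultimately have "contractible (induced S (neighbours S y - {x}))"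
      using del[of "rim S y" x] by (simp add: del_point_rim[OF ds])
    moreover have "(points S - {x}) \<inter> neighbours S y = neighbours S y - {x}"
      using neighbours_subset[of S y] by blast
    ultimately show ?thesis
      using contractible_remove_iff[OF ds, of "points S - {x}" y] p
      by (simp add: del_point_def)
  qed
  have "edge_closed S {x. contractible (del_point S x)}"
  proof (rule edge_closedI)
    fix x y assume xy: "{x, y} \<in> edges S" "x \<in> {x. contractible (del_point S x)}"
    have "points S - {x} - {y} = points S - {y} - {x}" "{y, x} \<in> edges S"
      using xy(1) by (auto simp: insert_commute)
    then show "y \<in> {x. contractible (del_point S x)}"
      using step[of x y] step[of y x] xy by simp
  qed
  from connected_spaceD[OF _ this, of v] show ?thesis
    using S v w by auto
qed

text \<open>The claims advance together: in the next dimension the first recognises rims of boundary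
  points as spheres, while the other two make the halves of such a rim into cells.\<close>

lemma digital_sphere_manifold_and_del_point:
  shows "(\<forall>(S :: 'a::infinite dgraph) A B. sphere_split n S A B \<longrightarrow> digital_sphere n S) \<and>
    (\<forall>S :: 'a dgraph. digital_sphere n S \<longrightarrow>
      manifold n S \<and> (\<forall>v \<in> points S. contractible (del_point S v)))"
proof (induction n)
  case 0
  have "contractible (del_point S v)" if "zero_sphere S" "v \<in> points S" for S :: "'a dgraph" and v
  proof -
    obtain a b where "a \<noteq> b" "S = ({a, b}, {})"
      using \<open>zero_sphere S\<close> by (auto simp: zero_sphere_def)
    then have "del_point S v = ({if v = a then b else a}, {})"
      using that(2) by (auto simp: del_point_def induced_def)
    then show ?thesis
      by (simp add: contractible_contr_trans.one_point)
  qed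
  then show ?case
    using sphere_split_0 by (auto simp: manifold_def)
next
  case (Suc n)
  have split: "digital_sphere n H" if "sphere_split n H A B" for H :: "'a dgraph" and A B
    using Suc that by blast
  have manifold: "manifold n S" if "digital_sphere n S" for S :: "'a dgraph"
    using Suc that by blast
  have del: "contractible (del_point S v)" if "digital_sphere n S" "v \<in> points S"
    for S :: "'a dgraph" and v
    using Suc that by blast
  have closed: "closed_manifold (Suc n) H" if "sphere_split (Suc n) H A B" for H :: "'a dgraph" and A B
    by (rule closed_manifold_sphere_split[OF _ _ _ that]) (erule split, erule manifold, erule (1) del)
  have "manifold (Suc n) S \<and> (\<forall>v \<in> points S. contractible (del_point S v))"
    if S: "digital_sphere (Suc n) S" for S :: "'a dgraph"
  \<comment> \<open>Spheres of dimension 1 are not defined by gluing, so no splitting is at hand and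
    the direct argument for cycles is used.\<close>
  proof (cases n)
    case 0
    then show ?thesis
      using S contractible_one_sphere_del_point[of S] by (auto simp: manifold_def one_sphere_def)
  next
    case (Suc m)
    obtain A B where AB: "sphere_split (Suc n) S A B"
      using digital_sphere_split[of m S] S unfolding Suc by blast
    have M: "closed_manifold (Suc n) S"
      by (rule closed[OF AB])
    have "digital_sphere n (induced S (A \<inter> B))"
      using AB cell_boundary[of S A n "A \<inter> B"] by (auto simp: sphere_split_def)
    \<comment> \<open>The common boundary is a sphere and so nonempty; any of its points starts the
      transfer to all points of \<open>S\<close>.\<close>
    then obtain v where "v \<in> A \<inter> B" "v \<in> points S"
      using points_manifold[OF manifold] by fastforce
    moreover from this have "contractible (del_point S v)"
      by (intro contractible_del_point_boundary[OF _ AB]) (erule (1) del)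
    ultimately have "contractible (del_point S w)" if "w \<in> points S" for w
      using that by (intro contractible_del_point_transfer[OF _ M, of v w]) (erule (1) del)
    then show ?thesis
      using M by (simp add: manifold_def del: closed_manifold.simps)
  qed
  moreover have "digital_sphere (Suc n) S" if "sphere_split (Suc n) S A B" for S :: "'a dgraph" and A B
    using digital_sphere_sphere_split[OF that] closed[OF that] by blast
  ultimately show ?case
    by blast
qed

theorem lemma4p4:
  fixes S :: "('a::infinite) dgraph" and v :: 'a and n :: nat
  assumes "n \<ge> 1"
    and "digital_sphere n S"
    and "v \<in> points S"
  shows "digital_disk n (del_point S v)"
proof (cases "n = 1")
  case True
  then show ?thesis
    using assms(2,3) by (simp del: split_paired_Ex) blast
next
  case False
  then have "n = Suc (Suc (n - 2))"
    using assms(1) by arith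
  then obtain m where n: "n = Suc (Suc m)"
    by blast
  have "manifold n S" and con: "contractible (del_point S v)"
    using digital_sphere_manifold_and_del_point[of n] assms(2,3) by blast+
  then have "closed_manifold n S"
    by (simp add: manifold_def n del: closed_manifold.simps)
  \<comment> \<open>\<open>S\<close> itself, with the point \<open>v\<close>, is the presentation
    required of a manifold with boundary; contractibility supplies the connectedness.\<close>
  then have "bounded_manifold n (del_point S v) (neighbours S v)"
    using assms(3) contractible_connected[OF con] by (rule bounded_manifold_del_point)
  then show ?thesis
    using con unfolding n by (rule digital_diskI)
qed

end
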